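(* For all $n,m\ge0$, \[ \mathcal{L}(x^nQ_m(x))=\sum_{\pi\in\mathrm{MS}_{n,m}}\mathrm{wt}(\pi), \] where $\mathrm{MS}_{n,m}$ is the set of Motzkin–Schröder paths from $(0,0)$ to $(n,m)$.
   Context: Let $\{b_n\}_{n\ge0},\{a_n\}_{n\ge0},\{\lambda_n\}_{n\ge0}$ be sequences of complex numbers. Define monic polynomials $P_n(x)$ by $P_{-1}(x)=0$, $P_0(x)=1$ and $P_{n+1}(x)=(x-b_n)P_n(x)-(a_nx+\lambda_n)P_{n-1}(x)$ for $n\ge0$. Let $d_0(x)=1$, $d_m(x)=\prod_{i=1}^m(a_ix+\lambda_i)$, and $Q_m(x)=P_m(x)/d_m(x)$. Assume $a_n\neq0$ and $P_n(-\lambda_n/a_n)\neq 0$ for all $n\ge1$. Let $V=\mathrm{span}\{x^nQ_m(x):n,m\ge0\}$ (rational functions), and let $\mathcal{L}$ be the unique linear functional on $V$ with $\mathcal{L}(1)=1$ and $\mathcal{L}(x^nQ_m(x))=0$ whenever $0\le n<m$. A Motzkin–Schröder path is a lattice path never going below the $x$-axis with steps: up $U=(1,1)$, horizontal $H=(1,0)$, vertical down $V=(0,-1)$, diagonal down $D=(1,-1)$. Its weight $\mathrm{wt}(\pi)$ is the product of step weights: each up step has weight $1$; a horizontal step starting at height $k$ has weight $b_k$; a vertical down step starting at height $k$ has weight $a_k$; a diagonal down step starting at height $k$ has weight $\lambda_k$. *)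

theory Defs
  imports Complex_Main "HOL-Library.Product_Plus"
    "HOL-Computational_Algebra.Computational_Algebra"
begin

definition ratfun_scale :: "complex \<Rightarrow> complex poly fract \<Rightarrow> complex poly fract"
  where "ratfun_scale c f = to_fract [:c:] * f"

global_interpretation ratfun: vector_space ratfun_scale
proof
  fix c c' :: complex and f g :: "complex poly fract"
  have *: "[:c + c':] = [:c:] + [:c':]" and **: "[:c * c':] = [:c:] * [:c':]" by simp_all
  show "ratfun_scale c (f + g) = ratfun_scale c f + ratfun_scale c g"
    by (simp add: ratfun_scale_def algebra_simps)
  show "ratfun_scale (c + c') f = ratfun_scale c f + ratfun_scale c' f"
    unfolding ratfun_scale_def * to_fract_add by (simp add: algebra_simps)
  show "ratfun_scale c (ratfun_scale c' f) = ratfun_scale (c * c') f"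
    unfolding ratfun_scale_def ** to_fract_mult by (simp add: algebra_simps)
  show "ratfun_scale 1 f = f"
    by (simp add: ratfun_scale_def flip: one_pCons)
qed

definition linear_functional_on ::
    "complex poly fract set \<Rightarrow> (complex poly fract \<Rightarrow> complex) \<Rightarrow> bool"
  where "linear_functional_on V L \<longleftrightarrow>
    (\<forall>f\<in>V. \<forall>g\<in>V. L (f + g) = L f + L g) \<and>
    (\<forall>c. \<forall>f\<in>V. L (ratfun_scale c f) = c * L f)"

text \<open>The second equation is the recurrence at index 0 with \<open>P\<^sub>-\<^sub>1 = 0\<close> substituted,
  so \<open>a 0\<close> and \<open>l 0\<close> never occur.\<close>

fun rec_poly ::
    "(nat \<Rightarrow> complex) \<Rightarrow> (nat \<Rightarrow> complex) \<Rightarrow> (nat \<Rightarrow> complex) \<Rightarrow> nat \<Rightarrow> complex poly"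
  where
    "rec_poly b a l 0 = 1"
  | "rec_poly b a l (Suc 0) = [:- b 0, 1:]"
  | "rec_poly b a l (Suc (Suc n)) =
       [:- b (Suc n), 1:] * rec_poly b a l (Suc n) -
       [:l (Suc n), a (Suc n):] * rec_poly b a l n"

definition den_poly :: "(nat \<Rightarrow> complex) \<Rightarrow> (nat \<Rightarrow> complex) \<Rightarrow> nat \<Rightarrow> complex poly"
  where "den_poly a l m = (\<Prod>i=1..m. [:l i, a i:])"

definition Q_fun ::
    "(nat \<Rightarrow> complex) \<Rightarrow> (nat \<Rightarrow> complex) \<Rightarrow> (nat \<Rightarrow> complex) \<Rightarrow> nat \<Rightarrow> complex poly fract"
  where "Q_fun b a l m = to_fract (rec_poly b a l m) / to_fract (den_poly a l m)"

definition ratfun_X :: "complex poly fract"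
  where "ratfun_X = to_fract [:0, 1:]"

definition V_space ::
    "(nat \<Rightarrow> complex) \<Rightarrow> (nat \<Rightarrow> complex) \<Rightarrow> (nat \<Rightarrow> complex) \<Rightarrow> complex poly fract set"
  where "V_space b a l = ratfun.span {ratfun_X ^ n * Q_fun b a l m | n m. True}"

text \<open>A path is the list of its steps, starting at the origin.\<close>

datatype ms_step = Up | Horizontal | Vertical_Down | Diagonal_Down

fun step_vec :: "ms_step \<Rightarrow> int \<times> int"
  where
    "step_vec Up = (1, 1)"
  | "step_vec Horizontal = (1, 0)"
  | "step_vec Vertical_Down = (0, -1)"
  | "step_vec Diagonal_Down = (1, -1)"

definition path_vertex :: "ms_step list \<Rightarrow> nat \<Rightarrow> int \<times> int"
  where "path_vertex p i = (\<Sum>j<i. step_vec (p ! j))"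

definition MS :: "nat \<Rightarrow> nat \<Rightarrow> ms_step list set"
  where "MS n m = {p. path_vertex p (length p) = (int n, int m) \<and>
    (\<forall>i\<le>length p. 0 \<le> snd (path_vertex p i))}"

fun step_wt ::
    "(nat \<Rightarrow> complex) \<Rightarrow> (nat \<Rightarrow> complex) \<Rightarrow> (nat \<Rightarrow> complex) \<Rightarrow> nat \<Rightarrow> ms_step \<Rightarrow> complex"
  where
    "step_wt b a l k Up = 1"
  | "step_wt b a l k Horizontal = b k"
  | "step_wt b a l k Vertical_Down = a k"
  | "step_wt b a l k Diagonal_Down = l k"

definition path_wt ::
    "(nat \<Rightarrow> complex) \<Rightarrow> (nat \<Rightarrow> complex) \<Rightarrow> (nat \<Rightarrow> complex) \<Rightarrow> ms_step list \<Rightarrow> complex"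
  where "path_wt b a l p =
    (\<Prod>i<length p. step_wt b a l (nat (snd (path_vertex p i))) (p ! i))"

text \<open>Every step moves by at least \<open>1\<close> in the direction \<open>(2, -1)\<close>, so a path from the origin
  to \<open>(n, m)\<close> has at most \<open>2 n - m\<close> steps; the sum over \<open>MS n m\<close> is thus a genuine finite sum.\<close>

lemma finite_MS: "finite (MS n m)"
proof (rule finite_subset)
  have bound: "int i \<le> 2 * fst (path_vertex p i) - snd (path_vertex p i)" for p i
  proof (induction i)
    case (Suc i)
    have "1 \<le> 2 * fst (step_vec s) - snd (step_vec s)" for s by (cases s) auto
    from this[of "p ! i"] Suc show ?case by (simp add: path_vertex_def)
  qed (simp add: path_vertex_def)
  show "MS n m \<subseteq> {p. set p \<subseteq> {Up, Horizontal, Vertical_Down, Diagonal_Down} \<and> length p \<le> 2 * n}"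
  proof
    fix p assume "p \<in> MS n m"
    then have "int (length p) \<le> 2 * int n - int m"
      using bound[of "length p" p] by (simp add: MS_def)
    moreover have "s \<in> {Up, Horizontal, Vertical_Down, Diagonal_Down}" for s by (cases s) auto
    ultimately show "p \<in> {p. set p \<subseteq> {Up, Horizontal, Vertical_Down, Diagonal_Down} \<and> length p \<le> 2 * n}"
      by auto
  qed
qed (rule finite_lists_length_le, simp)

end

theory Submission
  imports Defs
begin

text \<open>Dividing the recurrence for \<open>P\<^sub>m\<close> by \<open>d\<^sub>m\<close> gives
  \<open>x Q\<^sub>m = Q\<^sub>m\<^sub>-\<^sub>1 + b\<^sub>m Q\<^sub>m + a\<^sub>m\<^sub>+\<^sub>1 x Q\<^sub>m\<^sub>+\<^sub>1 + \<lambda>\<^sub>m\<^sub>+\<^sub>1 Q\<^sub>m\<^sub>+\<^sub>1\<close>. Multiplied by \<open>x\<^sup>n\<close>, the four terms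
  on the right correspond to the four possible last steps of a path to \<open>(n + 1, m)\<close>, so both
  sides of the theorem satisfy the same recurrence. Both vanish for \<open>n < m\<close> and equal \<open>1\<close> at
  the origin, which determines them by upward induction on \<open>n\<close> and, for each \<open>n\<close>,
  downward induction on \<open>m\<close>.\<close>

lemma path_vertex_append [simp]:
  "i \<le> length p \<Longrightarrow> path_vertex (p @ q) i = path_vertex p i"
  by (auto simp: path_vertex_def nth_append intro!: sum.cong)

lemma path_vertex_snoc [simp]:
  "path_vertex (p @ [s]) (Suc (length p)) = path_vertex p (length p) + step_vec s"
  by (simp add: path_vertex_def nth_append)

text \<open>Nonnegativity has to be asked only at the vertices of \<open>p\<close>, because the new
  endpoint has height \<open>int m\<close>.\<close>

lemma MS_snoc_iff:
  "p @ [s] \<in> MS n m \<longleftrightarrow>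
    path_vertex p (length p) + step_vec s = (int n, int m) \<and>
    (\<forall>i\<le>length p. 0 \<le> snd (path_vertex p i))"
  by (auto simp: MS_def le_Suc_eq simp flip: snd_add)

lemma MS_vertex: "p \<in> MS n m \<Longrightarrow> path_vertex p (length p) = (int n, int m)"
  by (simp add: MS_def)

lemma path_wt_snoc:
  assumes "p \<in> MS n m"
  shows "path_wt b a l (p @ [s]) = path_wt b a l p * step_wt b a l m s"
  using MS_vertex[OF assms] by (simp add: path_wt_def nth_append)

text \<open>No step increases the height minus the abscissa, which is 0 at the origin.\<close>

lemma MS_above_diagonal:
  assumes "n < m"
  shows "MS n m = {}"
proof -
  have "snd (path_vertex p i) \<le> fst (path_vertex p i)" for p i
  proof (induction i)
    case (Suc i)
    have "snd (step_vec s) \<le> fst (step_vec s)" for s by (cases s) auto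
    from this[of "p ! i"] Suc show ?case by (simp add: path_vertex_def)
  qed (simp add: path_vertex_def)
  from this[of _ "length _"] assms have "p \<notin> MS n m" for p
    by (metis MS_vertex fst_conv snd_conv of_nat_le_iff not_le)
  then show ?thesis by blast
qed

lemma MS_origin: "MS 0 0 = {[]}"
proof -
  have "p \<notin> MS 0 0" if "p \<noteq> []" for p
  proof -
    \<comment> \<open>Vertical steps keep the abscissa fixed, so the abscissa alone does not bound
      the length. Twice the abscissa minus the height grows by at least 1 with every step, so only
      the empty path returns to the origin.\<close>
    have bound: "int i \<le> 2 * fst (path_vertex p i) - snd (path_vertex p i)" for i
    proof (induction i)
      case (Suc i)
      have "1 \<le> 2 * fst (step_vec s) - snd (step_vec s)" for s by (cases s) auto
      from this[of "p ! i"] Suc show ?case by (simp add: path_vertex_def)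
    qed (simp add: path_vertex_def)
    from bound[of "length p"] that show ?thesis
      by (auto simp: MS_def)
  qed
  moreover have "[] \<in> MS 0 0" by (simp add: MS_def path_vertex_def zero_prod_def)
  ultimately show ?thesis by auto
qed

text \<open>The paths are sorted by their last step. A vertical step stays in column
  \<open>Suc n\<close>, and an up step cannot end at height 0.\<close>

lemma MS_Suc:
  "MS (Suc n) m =
    (case m of 0 \<Rightarrow> {} | Suc k \<Rightarrow> (\<lambda>p. p @ [Up]) ` MS n k) \<union>
    ((\<lambda>p. p @ [Horizontal]) ` MS n m \<union>
    ((\<lambda>p. p @ [Vertical_Down]) ` MS (Suc n) (Suc m) \<union>
     (\<lambda>p. p @ [Diagonal_Down]) ` MS n (Suc m)))" (is "_ = ?R")
proof (rule set_eqI)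
  fix q
  show "q \<in> MS (Suc n) m \<longleftrightarrow> q \<in> ?R"
  proof (cases q rule: rev_cases)
    case Nil
    then show ?thesis
      by (auto simp: MS_def path_vertex_def zero_prod_def split: nat.split)
  next
    case (snoc p s)
    obtain x y where xy: "path_vertex p (length p) = (x, y)" by fastforce
    \<comment> \<open>For \<open>m = 0\<close> this excludes an up step from height -1.\<close>
    have "(\<forall>i\<le>length p. 0 \<le> snd (path_vertex p i)) \<Longrightarrow> 0 \<le> y" using xy by force
    then show ?thesis
      unfolding snoc MS_snoc_iff xy
      by (cases s; cases m) (auto simp: MS_def xy image_iff)
  qed
qed

lemma sum_snoc_MS:
  "(\<Sum>q\<in>(\<lambda>p. p @ [s]) ` MS n m. path_wt b a l q) =
    step_wt b a l m s * (\<Sum>p\<in>MS n m. path_wt b a l p)"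
  by (subst sum.reindex) (auto simp: inj_on_def path_wt_snoc sum_distrib_left mult.commute)

lemma sum_MS_Suc:
  "(\<Sum>p\<in>MS (Suc n) m. path_wt b a l p) =
    (case m of 0 \<Rightarrow> 0 | Suc k \<Rightarrow> \<Sum>p\<in>MS n k. path_wt b a l p) +
    b m * (\<Sum>p\<in>MS n m. path_wt b a l p) +
    a (Suc m) * (\<Sum>p\<in>MS (Suc n) (Suc m). path_wt b a l p) +
    l (Suc m) * (\<Sum>p\<in>MS n (Suc m). path_wt b a l p)"
  unfolding MS_Suc[of n m]
  \<comment> \<open>The four images are disjoint because their members end in different steps; they
    are split off one at a time.\<close>
  apply (subst sum.union_disjoint)
     apply (auto simp: finite_MS split: nat.split)[3]
  apply (subst sum.union_disjoint)
     apply (auto simp: finite_MS)[3]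
  apply (subst sum.union_disjoint)
     apply (auto simp: finite_MS)[3]
  apply (simp add: sum_snoc_MS algebra_simps split: nat.split)
  done

lemma rec_poly_Suc:
  "rec_poly b a l (Suc m) = [:- b m, 1:] * rec_poly b a l m -
    (case m of 0 \<Rightarrow> 0 | Suc k \<Rightarrow> [:l m, a m:] * rec_poly b a l k)"
  by (cases m) simp_all

text \<open>This is the recurrence for \<open>rec_poly\<close> divided by
  \<open>den_poly a l m\<close>: on the left one linear factor is left over, and in the last term
  the factor of index \<open>m\<close> cancels. As each \<open>a k\<close> with
  \<open>k \<ge> 1\<close> is nonzero, all these factors are nonzero polynomials.\<close>

lemma Q_fun_Suc:
  assumes "\<forall>k\<ge>1. a k \<noteq> 0"
  shows "to_fract [:l (Suc m), a (Suc m):] * Q_fun b a l (Suc m) =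
    to_fract [:- b m, 1:] * Q_fun b a l m -
    (case m of 0 \<Rightarrow> 0 | Suc k \<Rightarrow> Q_fun b a l k)"
proof -
  have nz: "to_fract [:l (Suc k), a (Suc k):] \<noteq> 0" for k
    using assms by (simp add: to_fract_eq_0_iff)
  have d: "den_poly a l (Suc k) = [:l (Suc k), a (Suc k):] * den_poly a l k" for k
    by (simp add: den_poly_def mult.commute)
  have dnz: "to_fract (den_poly a l k) \<noteq> 0" for k
    using assms by (auto simp: den_poly_def to_fract_eq_0_iff)
  have "to_fract [:l (Suc m), a (Suc m):] * Q_fun b a l (Suc m) =
      to_fract (rec_poly b a l (Suc m)) / to_fract (den_poly a l m)"
    unfolding Q_fun_def d to_fract_mult times_divide_eq_right
    by (rule mult_divide_mult_cancel_left) (rule nz)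
  also have "\<dots> = to_fract [:- b m, 1:] * Q_fun b a l m -
    (case m of 0 \<Rightarrow> 0 | Suc k \<Rightarrow> Q_fun b a l k)"
  proof (cases m)
    case 0
    then show ?thesis by (simp add: Q_fun_def)
  next
    case (Suc k)
    show ?thesis
      using nz[of k] dnz[of k]
      by (simp only: Suc rec_poly_Suc[of _ _ _ "Suc k"] nat.case Q_fun_def d
          to_fract_mult to_fract_diff diff_divide_distrib) auto
  qed
  finally show ?thesis .
qed

lemma to_fract_linear: "to_fract [:c, d:] = to_fract [:c:] + to_fract [:d:] * ratfun_X"
  unfolding ratfun_X_def by (simp flip: to_fract_mult to_fract_add)

lemma X_times_Q_fun:
  assumes "\<forall>k\<ge>1. a k \<noteq> 0"
  shows "ratfun_X ^ Suc n * Q_fun b a l m =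
    (case m of 0 \<Rightarrow> 0 | Suc k \<Rightarrow> ratfun_X ^ n * Q_fun b a l k) +
    ratfun_scale (b m) (ratfun_X ^ n * Q_fun b a l m) +
    ratfun_scale (a (Suc m)) (ratfun_X ^ Suc n * Q_fun b a l (Suc m)) +
    ratfun_scale (l (Suc m)) (ratfun_X ^ n * Q_fun b a l (Suc m))"
proof -
  have b: "to_fract [:- b m, 1:] = ratfun_X - to_fract [:b m:]"
    unfolding ratfun_X_def by (simp flip: to_fract_diff)
  have "ratfun_X * Q_fun b a l m =
      (case m of 0 \<Rightarrow> 0 | Suc k \<Rightarrow> Q_fun b a l k) + to_fract [:b m:] * Q_fun b a l m +
      (to_fract [:l (Suc m):] + to_fract [:a (Suc m):] * ratfun_X) * Q_fun b a l (Suc m)"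
    using Q_fun_Suc[of a l m b, OF assms] unfolding b to_fract_linear[of "l (Suc m)"]
    by (simp add: algebra_simps)
  then have "ratfun_X ^ n * (ratfun_X * Q_fun b a l m) = ratfun_X ^ n * \<dots>"
    by simp
  then show ?thesis
    by (simp add: ratfun_scale_def algebra_simps split: nat.split)
qed

text \<open>\<open>L\<close> is linear only on \<open>V_space b a l\<close>, so every summand is
  shown to lie there before \<open>L\<close> is distributed over the sum.\<close>

lemma functional_X_times_Q_fun:
  assumes "\<forall>k\<ge>1. a k \<noteq> 0" and L: "linear_functional_on (V_space b a l) L"
  shows "L (ratfun_X ^ Suc n * Q_fun b a l m) =
    (case m of 0 \<Rightarrow> 0 | Suc k \<Rightarrow> L (ratfun_X ^ n * Q_fun b a l k)) +
    b m * L (ratfun_X ^ n * Q_fun b a l m) +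
    a (Suc m) * L (ratfun_X ^ Suc n * Q_fun b a l (Suc m)) +
    l (Suc m) * L (ratfun_X ^ n * Q_fun b a l (Suc m))"
proof -
  let ?V = "V_space b a l"
  have gen: "ratfun_X ^ i * Q_fun b a l j \<in> ?V" for i j
    unfolding V_space_def by (rule ratfun.span_base) blast
  have scale: "ratfun_scale c f \<in> ?V" if "f \<in> ?V" for c f
    using that unfolding V_space_def by (rule ratfun.span_scale)
  have add: "f + g \<in> ?V" if "f \<in> ?V" "g \<in> ?V" for f g
    using that unfolding V_space_def by (rule ratfun.span_add)
  have zero: "0 \<in> ?V"
    unfolding V_space_def by (rule ratfun.span_zero)
  have L_add: "L (f + g) = L f + L g" if "f \<in> ?V" "g \<in> ?V" for f g
    using L that by (simp add: linear_functional_on_def)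
  have L_scale: "L (ratfun_scale c f) = c * L f" if "f \<in> ?V" for c f
    using L that by (simp add: linear_functional_on_def)
  have L0: "L 0 = 0"
    using L_scale[OF zero, of 0] by (simp add: ratfun_scale_def)
  have up: "(case m of 0 \<Rightarrow> 0 | Suc k \<Rightarrow> ratfun_X ^ n * Q_fun b a l k) \<in> ?V"
    by (auto simp: zero gen split: nat.split)
  show ?thesis
    unfolding X_times_Q_fun[of a n b l m, OF assms(1)]
    by (simp only: L_add L_scale gen scale add up) (simp add: L0 split: nat.split)
qed

theorem theorem3p6:
  fixes b a l :: "nat \<Rightarrow> complex"
    and L :: "complex poly fract \<Rightarrow> complex"
    and n m :: nat
  assumes "\<And>k. k \<ge> 1 \<Longrightarrow> a k \<noteq> 0"
    and "\<And>k. k \<ge> 1 \<Longrightarrow> poly (rec_poly b a l k) (- l k / a k) \<noteq> 0"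
    and "linear_functional_on (V_space b a l) L"
    and "L 1 = 1"
    and "\<And>i j. i < j \<Longrightarrow> L (ratfun_X ^ i * Q_fun b a l j) = 0"
  shows "L (ratfun_X ^ n * Q_fun b a l m) = (\<Sum>p\<in>MS n m. path_wt b a l p)"
proof (induction n arbitrary: m)
  case 0
  show ?case
  proof (cases m)
    case 0
    then show ?thesis
      using assms(4) by (simp add: Q_fun_def den_poly_def MS_origin path_wt_def)
  next
    case (Suc k)
    then show ?thesis using assms(5)[of 0 m] by (simp add: MS_above_diagonal)
  qed
next
  case (Suc n)
  have nz: "\<forall>k\<ge>1. a k \<noteq> 0" using assms(1) by blast
  note outer = Suc.IH
  show ?case
  \<comment> \<open>The recurrence refers to height \<open>Suc m\<close> in the same column, so the
    induction runs downward in \<open>m\<close>. The truncated difference is 0 exactly for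
    \<open>m > Suc n\<close>, where both sides vanish.\<close>
  proof (induction "Suc (Suc n) - m" arbitrary: m)
    case 0
    then show ?case using assms(5)[of "Suc n" m] by (simp add: MS_above_diagonal)
  next
    case (Suc d)
    then have "L (ratfun_X ^ Suc n * Q_fun b a l (Suc m)) =
        (\<Sum>p\<in>MS (Suc n) (Suc m). path_wt b a l p)"
      by simp
    then show ?case
      by (simp only: functional_X_times_Q_fun[OF nz assms(3), of n m] sum_MS_Suc[of b a l n m] outer)
  qed
qed

end
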